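(* Let $m\ge 0$, $r\ge 1$ be integers, let $G$ be a connected graph with exactly $m$ edges and maximum degree at most $r$, and let $T$ be a cluster of $G$ with $e(B_T)<e(R_T)\le r$. Let $G'_T$ be the colex folding of $G$ at $T$. Then $G'_T$ has exactly $m$ edges and maximum degree at most $r$, and $k_t(G'_T)\ge k_t(G)$ for every $t\ge 2$.
   Context: All graphs are finite and simple; $e(H)$ is the number of edges of $H$ and $k_t(H)$ the number of cliques on exactly $t$ vertices. For a graph $G$ of maximum degree at most $r$, a nonempty clique $T$ is tight if the set $N(T)$ of common neighbours of all vertices of $T$ has size $r+1-|T|$; a cluster is an inclusion-maximal tight clique. For a cluster $T$: $S_T=N(T)$; $R_T$ is the complement of $G[S_T]$, i.e. the graph on $S_T$ whose edges are the pairs of $S_T$ not adjacent in $G$; $B_T$ is the graph of all edges $uv$ of $G$ with $u\in S_T$, $v\in V(G)\setminus(T\cup S_T)$. The colex graph $\mathcal{C}(n)$ is the graph on the positive integers whose edges are the first $n$ pairs $\{i<j\}$ in the order where $\{i<j\}$ precedes $\{i'<j'\}$ iff $j<j'$ or ($j=j'$ and $i<i'$). The colex folding of $G$ at $T$ is $G'_T=G[V(G)\setminus(T\cup S_T)]\cup \mathcal{C}\bigl(\binom{r+1}{2}-e(R_T)+e(B_T)\bigr)$ (disjoint union). *)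

theory Defs
  imports Complex_Main
begin

record 'a ugraph =
  uverts :: "'a set"
  uedges :: "'a set set"

definition simple_graph :: "'a ugraph \<Rightarrow> bool" where
  "simple_graph G \<longleftrightarrow> (\<forall>e\<in>uedges G. e \<subseteq> uverts G \<and> card e = 2)"

definition adj :: "'a ugraph \<Rightarrow> 'a \<Rightarrow> 'a \<Rightarrow> bool" where
  "adj G u v \<longleftrightarrow> {u, v} \<in> uedges G"

definition num_edges :: "'a ugraph \<Rightarrow> nat" where
  "num_edges G = card (uedges G)"

definition degree :: "'a ugraph \<Rightarrow> 'a \<Rightarrow> nat" where
  "degree G v = card {u \<in> uverts G. adj G v u}"

definition max_degree_le :: "'a ugraph \<Rightarrow> nat \<Rightarrow> bool" where
  "max_degree_le G r \<longleftrightarrow> (\<forall>v\<in>uverts G. degree G v \<le> r)"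

definition connected_graph :: "'a ugraph \<Rightarrow> bool" where
  "connected_graph G \<longleftrightarrow>
     uverts G \<noteq> {} \<and> (\<forall>u\<in>uverts G. \<forall>v\<in>uverts G. (adj G)\<^sup>*\<^sup>* u v)"

definition clique :: "'a ugraph \<Rightarrow> 'a set \<Rightarrow> bool" where
  "clique G K \<longleftrightarrow> K \<subseteq> uverts G \<and> (\<forall>u\<in>K. \<forall>v\<in>K. u \<noteq> v \<longrightarrow> adj G u v)"

definition num_cliques :: "nat \<Rightarrow> 'a ugraph \<Rightarrow> nat" where
  "num_cliques t G = card {K. clique G K \<and> finite K \<and> card K = t}"

definition induced :: "'a ugraph \<Rightarrow> 'a set \<Rightarrow> 'a ugraph" where
  "induced G W =
     \<lparr>uverts = uverts G \<inter> W, uedges = {e \<in> uedges G. e \<subseteq> W}\<rparr>"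

definition complement :: "'a ugraph \<Rightarrow> 'a ugraph" where
  "complement G =
     \<lparr>uverts = uverts G,
      uedges = {{u, v} | u v. u \<in> uverts G \<and> v \<in> uverts G \<and> u \<noteq> v \<and> \<not> adj G u v}\<rparr>"

definition disjoint_union :: "'a ugraph \<Rightarrow> 'b ugraph \<Rightarrow> ('a + 'b) ugraph" where
  "disjoint_union G H =
     \<lparr>uverts = uverts G <+> uverts H,
      uedges = (\<lambda>e. Inl ` e) ` uedges G \<union> (\<lambda>e. Inr ` e) ` uedges H\<rparr>"

definition common_nbrs :: "'a ugraph \<Rightarrow> 'a set \<Rightarrow> 'a set" where
  "common_nbrs G T = {v \<in> uverts G. \<forall>u\<in>T. adj G u v}"

text \<open>The size condition \<open>|N(T)| = r + 1 - |T|\<close> is written additively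
  to avoid truncated subtraction.\<close>

definition tight :: "'a ugraph \<Rightarrow> nat \<Rightarrow> 'a set \<Rightarrow> bool" where
  "tight G r T \<longleftrightarrow>
     T \<noteq> {} \<and> clique G T \<and> card (common_nbrs G T) + card T = r + 1"

definition cluster :: "'a ugraph \<Rightarrow> nat \<Rightarrow> 'a set \<Rightarrow> bool" where
  "cluster G r T \<longleftrightarrow> tight G r T \<and> (\<forall>T'. tight G r T' \<and> T \<subseteq> T' \<longrightarrow> T' = T)"

definition R_graph :: "'a ugraph \<Rightarrow> 'a set \<Rightarrow> 'a ugraph" where
  "R_graph G T = complement (induced G (common_nbrs G T))"

definition B_graph :: "'a ugraph \<Rightarrow> 'a set \<Rightarrow> 'a ugraph" where
  "B_graph G T =
     (let E = {{u, v} | u v. {u, v} \<in> uedges G \<and> u \<in> common_nbrs G T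
                 \<and> v \<in> uverts G - (T \<union> common_nbrs G T)}
      in \<lparr>uverts = \<Union>E, uedges = E\<rparr>)"

definition colex_pairs :: "(nat \<times> nat) set" where
  "colex_pairs = {(i, j). 1 \<le> i \<and> i < j}"

definition colex_less :: "nat \<times> nat \<Rightarrow> nat \<times> nat \<Rightarrow> bool" where
  "colex_less p q \<longleftrightarrow> snd p < snd q \<or> snd p = snd q \<and> fst p < fst q"

text \<open>A pair is among the first \<open>n\<close> iff it has fewer than \<open>n\<close> predecessors.
  The vertex set is infinite, but the edge set is finite (see below), so edge counts,
  degrees and numbers of \<open>t\<close>-cliques with \<open>t \<ge> 2\<close> are genuine cardinalities.\<close>

definition colex_graph :: "nat \<Rightarrow> nat ugraph" where
  "colex_graph n =
     \<lparr>uverts = {1..},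
      uedges = {{i, j} | i j. (i, j) \<in> colex_pairs
                  \<and> card {p \<in> colex_pairs. colex_less p (i, j)} < n}\<rparr>"

definition colex_folding :: "'a ugraph \<Rightarrow> nat \<Rightarrow> 'a set \<Rightarrow> ('a + nat) ugraph" where
  "colex_folding G r T =
     disjoint_union
       (induced G (uverts G - (T \<union> common_nbrs G T)))
       (colex_graph ((r + 1 choose 2) - num_edges (R_graph G T) + num_edges (B_graph G T)))"

lemma simple_graph_colex: "simple_graph (colex_graph n)"
  by (auto simp: simple_graph_def colex_graph_def colex_pairs_def)

lemma finite_colex_predecessors: "finite {p \<in> colex_pairs. colex_less p q}"
proof (rule finite_subset)
  show "{p \<in> colex_pairs. colex_less p q} \<subseteq> {..snd q} \<times> {..snd q}"
    by (auto simp: colex_pairs_def colex_less_def)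
qed simp

lemma finite_uedges_colex: "finite (uedges (colex_graph n))"
proof -
  have bound: "j < n + 2"
    if "(i, j) \<in> colex_pairs" "card {p \<in> colex_pairs. colex_less p (i, j)} < n" for i j
  proof -
    have "Pair 1 ` {2..<j} \<subseteq> {p \<in> colex_pairs. colex_less p (i, j)}"
      by (auto simp: colex_pairs_def colex_less_def)
    then have "card (Pair (1::nat) ` {2..<j}) \<le> card {p \<in> colex_pairs. colex_less p (i, j)}"
      by (intro card_mono finite_colex_predecessors)
    moreover have "card (Pair (1::nat) ` {2..<j}) = j - 2"
      by (simp add: card_image inj_on_def)
    ultimately show ?thesis
      using that(2) by linarith
  qed
  have "e \<subseteq> {..<n + 2}" if e: "e \<in> uedges (colex_graph n)" for e
  proof -
    obtain i j where ij: "e = {i, j}" "(i, j) \<in> colex_pairs"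
      "card {p \<in> colex_pairs. colex_less p (i, j)} < n"
      using e unfolding colex_graph_def ugraph.simps by blast
    have "j < n + 2" by (rule bound[OF ij(2,3)])
    moreover have "i < j" using ij(2) by (simp add: colex_pairs_def)
    ultimately show ?thesis using ij(1) by simp
  qed
  then have "uedges (colex_graph n) \<subseteq> Pow {..<n + 2}" by blast
  then show ?thesis by (rule finite_subset) simp
qed

end

theory Submission
  imports Defs
begin

text \<open>Put \<open>W = T \<union> S\<close>, so that \<open>|W| = r + 1\<close>, \<open>\<rho> = e(R)\<close> and \<open>\<beta> = e(B)\<close>. Vertices of \<open>T\<close> already
  have degree \<open>r\<close> inside \<open>W\<close>, so a \<open>t\<close>-clique meeting \<open>W\<close> either lies in \<open>W\<close>, where it is an independent
  set of \<open>R\<close>, or it crosses the boundary of \<open>W\<close> through edges of \<open>B\<close> only. Since \<open>\<rho> \<le> r\<close>, the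
  former number at most \<open>C(r,t) + C(r-\<rho>,t-1)\<close>, the extremal case being a star. Each of the latter
  is the union of \<open>t - 1\<close> edges of \<open>B\<close>, so they number at most \<open>C(\<beta>,t-1)\<close>. The new colex component
  is \<open>K\<^sub>r\<close> with one further vertex joined to \<open>c = r - \<rho> + \<beta> < r\<close> of its vertices, which has
  \<open>C(r,t) + C(c,t-1) \<ge> C(r,t) + C(r-\<rho>,t-1) + C(\<beta>,t-1)\<close> cliques of size \<open>t\<close>.\<close>

section \<open>Binomial inequalities and sets avoiding few edges\<close>

text \<open>By Pascal's rule, raising \<open>y\<close> by one adds \<open>y choose k\<close> on the
  left and the at least as large \<open>(x + y) choose k\<close> on the right. The index is
  \<open>Suc k\<close> because at index 0 the claim would read 1 + 1 \<le> 1.\<close>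

lemma binomial_superadditive:
  fixes x y k :: nat
  shows "(x choose Suc k) + (y choose Suc k) \<le> (x + y) choose Suc k"
proof (induction y)
  case (Suc y)
  have "y choose k \<le> (x + y) choose k"
    by (rule binomial_right_mono) simp
  with Suc show ?case by simp
qed simp

text \<open>When the edge \<open>e\<close> is added to \<open>q\<close> earlier ones, deleting from each earlier edge a vertex outside \<open>e\<close>
  leaves at least \<open>r - 1 - q\<close> vertices, any \<open>k\<close> of which together with \<open>e\<close> form a set destroyed by
  \<open>e\<close> alone.\<close>

lemma card_edge_free_subsets_le:
  fixes W :: "'a set"
  assumes "finite F" and "finite W" and "card W = Suc r"
    and "\<And>e. e \<in> F \<Longrightarrow> e \<subseteq> W \<and> card e = 2" and "card F \<le> r"
  shows "card {K. K \<subseteq> W \<and> card K = k + 2 \<and> (\<forall>e\<in>F. \<not> e \<subseteq> K)}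
    \<le> (r choose (k + 2)) + ((r - card F) choose (k + 1))"
  using assms(1,4,5)
proof (induction F rule: finite_induct)
  case empty
  \<comment> \<open>With no edges the bound is an equality, namely Pascal's rule for subsets of an
    (r+1)-set.\<close>
  show ?case using n_subsets[OF assms(2), of "k + 2"] assms(3) by simp
next
  case (insert e F)
  define q where "q = card F"
  have q: "q < r" using insert.hyps insert.prems(2) by (simp add: q_def)
  have e: "e \<subseteq> W" "card e = 2" using insert.prems(1) by auto
  then have fin_e: "finite e" by (metis assms(2) finite_subset)
  have "\<exists>x. x \<in> d - e" if "d \<in> F" for d
  proof (rule ccontr)
    assume "\<nexists>x. x \<in> d - e"
    then have "d \<subseteq> e" by blast
    moreover have "card d = card e" using that insert.prems(1) by simp
    ultimately have "d = e" using fin_e by (metis card_subset_eq)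
    with that insert.hyps(2) show False by simp
  qed
  then obtain f where f: "\<And>d. d \<in> F \<Longrightarrow> f d \<in> d - e" by metis
  \<comment> \<open>Each \<open>f d\<close> lies outside \<open>e\<close>, so it is still missing
    after \<open>e\<close> is added to a subset of \<open>D\<close>. Several edges may share the
    same chosen vertex, hence only a lower bound on \<open>card D\<close>.\<close>
  define D where "D = W - e - f ` F"
  have fin_D: "finite D" by (simp add: D_def assms(2))
  have "card (f ` F) \<le> q" unfolding q_def by (rule card_image_le[OF insert.hyps(1)])
  moreover have "card (W - e) = r - 1" using card_Diff_subset[OF fin_e e(1)] e(2) assms(3) by simp
  ultimately have card_D: "r - 1 - q \<le> card D"
    unfolding D_def using diff_card_le_card_Diff[of "f ` F" "W - e"] insert.hyps(1) by simp
  let ?free = "\<lambda>F. {K. K \<subseteq> W \<and> card K = k + 2 \<and> (\<forall>e\<in>F. \<not> e \<subseteq> K)}"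
  let ?new = "(\<lambda>A. A \<union> e) ` {A. A \<subseteq> D \<and> card A = k}"
  have fin_free: "finite (?free F)" by (rule finite_subset[of _ "Pow W"]) (auto simp: assms(2))
  have new: "?new \<subseteq> ?free F"
  proof (clarsimp, intro conjI ballI)
    fix A assume A: "A \<subseteq> D"
    show "A \<subseteq> W" "e \<subseteq> W" using A e by (auto simp: D_def)
    show "card (A \<union> e) = Suc (Suc (card A))"
      using A e(2) fin_e by (subst card_Un_disjoint) (auto simp: D_def intro: finite_subset[OF A fin_D])
    show "\<not> d \<subseteq> A \<union> e" if "d \<in> F" for d using f[OF that] A that by (auto simp: D_def)
  qed
  have "inj_on (\<lambda>A. A \<union> e) {A. A \<subseteq> D \<and> card A = k}"
    by (rule inj_onI) (auto simp: D_def)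
  then have card_new: "card ?new = card D choose k"
    by (simp add: card_image n_subsets[OF fin_D])
  have sub: "?free (insert e F) \<subseteq> ?free F - ?new" by auto
  have "card (?free (insert e F)) \<le> card (?free F) - card ?new"
    using card_mono[OF _ sub] card_Diff_subset[OF finite_subset[OF new fin_free] new] fin_free by simp
  also have "\<dots> \<le> card (?free F) - ((r - 1 - q) choose k)"
    using card_new binomial_right_mono[OF card_D, of k] by simp
  also have "\<dots> \<le> (r choose (k + 2)) + ((r - q) choose (k + 1)) - ((r - 1 - q) choose k)"
    using insert.IH insert.prems q by (simp add: q_def diff_le_mono)
  \<comment> \<open>With n = r - 1 - q this is C(n+1,k+1) = C(n,k) + C(n,k+1), which also shows that
    the subtraction does not truncate.\<close>
  also have "\<dots> = (r choose (k + 2)) + ((r - Suc q) choose (k + 1))"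
  proof -
    obtain n where "r = Suc (q + n)" using q less_imp_Suc_add by blast
    then show ?thesis by (simp del: binomial_Suc_Suc add: binomial_Suc_Suc[of n k] Suc_diff_le)
  qed
  finally show ?case using insert.hyps by (simp add: q_def)
qed

section \<open>Finiteness and adjacency in simple graphs\<close>

lemma uedges_finite:
  assumes "simple_graph G" and "finite (uverts G)"
  shows "finite (uedges G)"
  by (rule finite_subset[of _ "Pow (uverts G)"]) (use assms in \<open>auto simp: simple_graph_def\<close>)

lemma adj_sym: "adj G u v \<longleftrightarrow> adj G v u"
  by (simp add: adj_def insert_commute)

lemma adjD:
  assumes "simple_graph G" and "adj G u v"
  shows "u \<noteq> v" and "u \<in> uverts G" and "v \<in> uverts G"
proof -
  from assms have *: "{u, v} \<subseteq> uverts G" "card {u, v} = 2"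
    unfolding simple_graph_def adj_def by blast+
  then show "u \<noteq> v" "u \<in> uverts G" "v \<in> uverts G" by auto
qed

text \<open>Serves graphs with infinitely many vertices, such as \<open>colex_graph\<close>: for
  \<open>t \<ge> 2\<close> every vertex of a \<open>t\<close>-clique lies on an edge, so all these
  cliques live in the finite union of the edges.\<close>

lemma cliques_finite:
  assumes "finite (uedges G)" and "\<And>e. e \<in> uedges G \<Longrightarrow> finite e" and "t \<ge> 2"
  shows "finite {K. clique G K \<and> finite K \<and> card K = t}"
proof (rule finite_subset)
  show "finite (Pow (\<Union>(uedges G)))" using assms by blast
  show "{K. clique G K \<and> finite K \<and> card K = t} \<subseteq> Pow (\<Union>(uedges G))"
  proof clarify
    fix K x assume K: "clique G K" "finite K" "t = card K" "x \<in> K"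
    then have "K \<noteq> {x}" using assms(3) by auto
    then obtain y where "y \<in> K" "y \<noteq> x" using K by blast
    then have "{x, y} \<in> uedges G" using K by (auto simp: clique_def adj_def)
    then show "x \<in> \<Union>(uedges G)" by blast
  qed
qed

section \<open>Shape, degrees and cliques of the colex graph\<close>

lemma card_colex_pairs_below:
  "finite {(a, b). 1 \<le> a \<and> a < b \<and> b < Suc j} \<and>
   card {(a::nat, b). 1 \<le> a \<and> a < b \<and> b < Suc j} = j choose 2"
proof (induction j)
  case 0
  have *: "{(a::nat, b). 1 \<le> a \<and> a < b \<and> b < Suc 0} = {}" by auto
  show ?case unfolding * by simp
next
  case (Suc j)
  have *: "{(a::nat, b). 1 \<le> a \<and> a < b \<and> b < Suc (Suc j)}
      = {(a, b). 1 \<le> a \<and> a < b \<and> b < Suc j} \<union> (\<lambda>a. (a, Suc j)) ` {1..j}"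
    by auto
  have "card ((\<lambda>a. (a, Suc j)) ` {1..j}) = j" by (simp add: card_image inj_on_def)
  then show ?case unfolding * using Suc
    by (subst card_Un_disjoint) (auto simp: numeral_2_eq_2)
qed

text \<open>First come all pairs within \<open>{1..j}\<close>, then the pairs with the same larger
  endpoint \<open>Suc j\<close> and smaller endpoint below \<open>i\<close>.\<close>

lemma card_colex_predecessors:
  assumes "1 \<le> i" and "i \<le> j"
  shows "card {p \<in> colex_pairs. colex_less p (i, Suc j)} = (j choose 2) + (i - 1)"
proof -
  have *: "{p \<in> colex_pairs. colex_less p (i, Suc j)}
      = {(a, b). 1 \<le> a \<and> a < b \<and> b < Suc j} \<union> (\<lambda>a. (a, Suc j)) ` {1..<i}"
    using assms by (auto simp: colex_pairs_def colex_less_def)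
  have "card ((\<lambda>a. (a, Suc j)) ` {1..<i}) = i - 1" by (simp add: card_image inj_on_def)
  then show ?thesis unfolding * using card_colex_pairs_below[of j]
    by (subst card_Un_disjoint) auto
qed

text \<open>The pairs within \<open>{1..r}\<close> occupy the first \<open>r choose 2\<close>
  places, forming a complete graph; the next \<open>c\<close> pairs join the new vertex
  \<open>Suc r\<close> to 1, ..., c.\<close>

lemma uedges_colex_graph:
  assumes "c < r"
  shows "uedges (colex_graph ((r choose 2) + c))
    = {e. e \<subseteq> {1..r} \<and> card e = 2} \<union> (\<lambda>i. {i, Suc r}) ` {1..c}"
proof -
  have iff: "card {p \<in> colex_pairs. colex_less p (i, j)} < (r choose 2) + c
      \<longleftrightarrow> j \<le> r \<or> j = Suc r \<and> i \<le> c" if "1 \<le> i" "i < j" for i j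
  proof -
    from that obtain l where l: "j = Suc l" "i \<le> l" by (cases j) auto
    have *: "card {p \<in> colex_pairs. colex_less p (i, j)} = (l choose 2) + (i - 1)"
      using card_colex_predecessors that l by simp
    \<comment> \<open>Since i - 1 < l, a pair with l < r has fewer than
      \<open>Suc l choose 2\<close> \<le> \<open>r choose 2\<close> predecessors. For l = r the
      condition becomes i - 1 < c, that is i \<le> c. For larger l the pairs within
      \<open>{1..Suc r}\<close> alone are too many.\<close>
    consider "l < r" | "l = r" | "Suc r \<le> l" by linarith
    then show ?thesis
    proof cases
      case 1
      then have "Suc l choose 2 \<le> r choose 2" by (intro binomial_right_mono) simp
      then have "(l choose 2) + l \<le> r choose 2" by (simp add: numeral_2_eq_2)
      then show ?thesis using 1 l that unfolding * by simp
    next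
      case 2
      then show ?thesis using l that unfolding * by auto
    next
      case 3
      then have "Suc r choose 2 \<le> l choose 2" by (rule binomial_right_mono)
      then have "(r choose 2) + r \<le> l choose 2" by (simp add: numeral_2_eq_2)
      then show ?thesis using 3 l assms unfolding * by simp
    qed
  qed
  have "uedges (colex_graph ((r choose 2) + c))
      = {{i, j} |i j. 1 \<le> i \<and> i < j \<and> (j \<le> r \<or> j = Suc r \<and> i \<le> c)}"
    using iff by (auto simp: colex_graph_def colex_pairs_def)
  also have "\<dots> = {e. e \<subseteq> {1..r} \<and> card e = 2} \<union> (\<lambda>i. {i, Suc r}) ` {1..c}" (is "?L = ?R")
  proof
    show "?L \<subseteq> ?R" by auto
    show "?R \<subseteq> ?L"
    proof
      fix e assume "e \<in> ?R"
      then consider "e \<subseteq> {1..r}" "card e = 2" | i where "e = {i, Suc r}" "i \<in> {1..c}" by blast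
      then show "e \<in> ?L"
      proof cases
        case 1
        then obtain x y where "e = {x, y}" "x \<noteq> y" by (auto simp: card_2_iff)
        then have "e = {min x y, max x y}" "min x y < max x y" by (auto simp: min_def max_def)
        moreover have "1 \<le> min x y" "max x y \<le> r" using 1 \<open>e = {x, y}\<close> by auto
        ultimately show ?thesis by blast
      next
        case 2
        then have "e = {i, Suc r} \<and> 1 \<le> i \<and> i < Suc r \<and> (Suc r \<le> r \<or> Suc r = Suc r \<and> i \<le> c)"
          using assms by simp
        then show ?thesis by blast
      qed
    qed
  qed
  finally show ?thesis .
qed

lemma num_edges_colex_graph:
  assumes "c < r"
  shows "num_edges (colex_graph ((r choose 2) + c)) = (r choose 2) + c"
proof -
  have "card ((\<lambda>i. {i, Suc r}) ` {1..c}) = c"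
    using assms by (subst card_image) (auto simp: inj_on_def doubleton_eq_iff)
  moreover have "card {e. e \<subseteq> {1..r} \<and> card e = 2} = r choose 2"
    by (simp add: n_subsets)
  moreover have "finite {e. e \<subseteq> {1..r} \<and> card e = 2}"
    by (rule finite_subset[of _ "Pow {1..r}"]) auto
  ultimately show ?thesis
    unfolding num_edges_def uedges_colex_graph[OF assms]
    by (subst card_Un_disjoint) auto
qed

text \<open>All edges lie within the r + 1 vertices \<open>{1..Suc r}\<close>; the rest of the
  infinite vertex set is isolated.\<close>

lemma degree_colex_graph_le:
  assumes "c < r"
  shows "degree (colex_graph ((r choose 2) + c)) v \<le> r"
proof (cases "v \<in> {1..Suc r}")
  case True
  have "{u \<in> uverts (colex_graph ((r choose 2) + c)). adj (colex_graph ((r choose 2) + c)) v u}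
      \<subseteq> {1..Suc r} - {v}"
    using assms adjD(1)[OF simple_graph_colex]
    by (fastforce simp: adj_def uedges_colex_graph[OF assms] doubleton_eq_iff)
  then have "degree (colex_graph ((r choose 2) + c)) v \<le> card ({1..Suc r} - {v})"
    unfolding degree_def by (intro card_mono) auto
  then show ?thesis using True by simp
next
  case False
  then have "{u \<in> uverts (colex_graph ((r choose 2) + c)). adj (colex_graph ((r choose 2) + c)) v u} = {}"
    using assms by (auto simp: adj_def uedges_colex_graph[OF assms] doubleton_eq_iff)
  then show ?thesis unfolding degree_def by (metis card.empty le0)
qed

text \<open>\<open>?A\<close> collects the cliques of the complete graph on \<open>{1..r}\<close>,
  and \<open>?B\<close> those through the extra vertex \<open>Suc r\<close>, whose other k + 1
  vertices are among its \<open>c\<close> neighbours.\<close>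

lemma num_cliques_colex_graph_ge:
  assumes "c < r"
  shows "num_cliques (k + 2) (colex_graph ((r choose 2) + c))
    \<ge> (r choose (k + 2)) + (c choose (k + 1))"
proof -
  let ?C = "colex_graph ((r choose 2) + c)"
  let ?A = "{K. K \<subseteq> {1..r} \<and> card K = k + 2}"
  let ?B = "insert (Suc r) ` {K. K \<subseteq> {1..c} \<and> card K = k + 1}"
  have adj: "adj ?C x y" if "x \<in> {1..r}" "y \<in> {1..r}" "x \<noteq> y" for x y
    using that by (auto simp: adj_def uedges_colex_graph[OF assms])
  have adj': "adj ?C x (Suc r)" if "x \<in> {1..c}" for x
    using that by (auto simp: adj_def uedges_colex_graph[OF assms])
  have cr: "{1..c} \<subseteq> {1..r}" using assms by auto
  have verts: "uverts ?C = {1..}" by (simp add: colex_graph_def)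
  have A: "?A \<subseteq> {K. clique ?C K \<and> finite K \<and> card K = k + 2}"
  proof clarify
    fix K assume K: "K \<subseteq> {1..r}" "card K = k + 2"
    then have "clique ?C K" unfolding clique_def verts using adj
      by (meson atLeastAtMost_iff atLeast_iff subset_iff)
    with K show "clique ?C K \<and> finite K \<and> card K = k + 2" by (auto intro: finite_subset)
  qed
  have B: "?B \<subseteq> {K. clique ?C K \<and> finite K \<and> card K = k + 2}"
  proof clarify
    fix K assume K: "K \<subseteq> {1..c}" "card K = k + 1"
    then have "finite K" "Suc r \<notin> K" using assms by (auto intro: finite_subset)
    moreover have "clique ?C (insert (Suc r) K)"
      unfolding clique_def verts
    proof (intro conjI ballI impI)
      fix u v assume uv: "u \<in> insert (Suc r) K" "v \<in> insert (Suc r) K" "u \<noteq> v"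
      then consider "u = Suc r" "v \<in> K" | "v = Suc r" "u \<in> K" | "u \<in> K" "v \<in> K" by blast
      then show "adj ?C u v"
      proof cases
        case 1
        then have "adj ?C v u" using adj' K by blast
        then show ?thesis by (subst adj_sym)
      next
        case 2
        then show ?thesis using adj' K by blast
      next
        case 3
        then show ?thesis using adj uv(3) K cr by blast
      qed
    qed (use K in auto)
    ultimately show "clique ?C (insert (Suc r) K) \<and> finite (insert (Suc r) K)
        \<and> card (insert (Suc r) K) = k + 2"
      using K by simp
  qed
  have inj: "inj_on (insert (Suc r)) {K. K \<subseteq> {1..c} \<and> card K = k + 1}"
  proof (rule inj_onI)
    fix K L assume "K \<in> {K. K \<subseteq> {1..c} \<and> card K = k + 1}"
      "L \<in> {K. K \<subseteq> {1..c} \<and> card K = k + 1}" "insert (Suc r) K = insert (Suc r) L"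
    moreover have "Suc r \<notin> {1..c}" using assms by simp
    ultimately show "K = L" by (metis (mono_tags, lifting) insert_ident mem_Collect_eq subsetD)
  qed
  have "finite ?A" by (rule finite_subset[of _ "Pow {1..r}"]) auto
  moreover have "finite ?B" by (rule finite_imageI, rule finite_subset[of _ "Pow {1..c}"]) auto
  moreover have "?A \<inter> ?B = {}" by auto
  ultimately have "card (?A \<union> ?B) = card ?A + card ?B" by (rule card_Un_disjoint)
  moreover have "card ?A = r choose (k + 2)" "card ?B = c choose (k + 1)"
    unfolding card_image[OF inj] by (simp_all add: n_subsets)
  moreover have "card (?A \<union> ?B) \<le> num_cliques (k + 2) ?C"
    unfolding num_cliques_def
  proof (rule card_mono)
    have "finite e" if "e \<in> uedges ?C" for e
      using that simple_graph_colex unfolding simple_graph_def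
      by (metis card.infinite zero_neq_numeral)
    then show "finite {K. clique ?C K \<and> finite K \<and> card K = k + 2}"
      by (intro cliques_finite finite_uedges_colex) auto
    show "?A \<union> ?B \<subseteq> {K. clique ?C K \<and> finite K \<and> card K = k + 2}"
      by (rule Un_least[OF A B])
  qed
  ultimately show ?thesis by simp
qed

section \<open>Edges, degrees and cliques of disjoint unions\<close>

text \<open>\<open>Inl\<close> and \<open>Inr\<close> have the same image only on the empty set, so
  excluding an empty edge from one side makes the two edge families disjoint.\<close>

lemma num_edges_disjoint_union:
  assumes "finite (uedges G)" and "finite (uedges H)" and "{} \<notin> uedges G"
  shows "num_edges (disjoint_union G H) = num_edges G + num_edges H"
proof -
  have "inj (image (Inl :: 'a \<Rightarrow> 'a + 'b))" "inj (image (Inr :: 'b \<Rightarrow> 'a + 'b))"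
    by (simp_all add: inj_image_eq_iff inj_def)
  moreover have "(\<lambda>e. Inl ` e :: ('a + 'b) set) ` uedges G \<inter> (\<lambda>e. Inr ` e) ` uedges H = {}"
  proof -
    have False if ef: "e \<in> uedges G" "Inl ` e = (Inr ` f :: ('a + 'b) set)" for e f
    proof -
      have "e \<noteq> {}" using ef(1) assms(3) by blast
      then obtain x where "x \<in> e" by blast
      then have "Inl x \<in> (Inr ` f :: ('a + 'b) set)" using ef(2) by blast
      then show False by blast
    qed
    then show ?thesis by blast
  qed
  ultimately show ?thesis
    unfolding num_edges_def disjoint_union_def
    using assms by (simp add: card_Un_disjoint card_image inj_on_subset)
qed

lemma adj_disjoint_union:
  "adj (disjoint_union G H) (Inl x) (Inl y) \<longleftrightarrow> adj G x y"
  "adj (disjoint_union G H) (Inr x') (Inr y') \<longleftrightarrow> adj H x' y'"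
  "\<not> adj (disjoint_union G H) (Inl x) (Inr y')"
  "\<not> adj (disjoint_union G H) (Inr x') (Inl y)"
proof -
  have Inl: "Inl ` e = ({Inl x, Inl y} :: ('a + 'b) set) \<longleftrightarrow> e = {x, y}" for e
    using inj_image_eq_iff[of Inl e "{x, y}"] by simp
  have Inr: "Inr ` e = ({Inr x', Inr y'} :: ('a + 'b) set) \<longleftrightarrow> e = {x', y'}" for e
    using inj_image_eq_iff[of Inr e "{x', y'}"] by simp
  have Inl': "Inr ` e \<noteq> ({Inl x, Inl y} :: ('a + 'b) set)" for e by auto
  have Inr': "Inl ` e \<noteq> ({Inr x', Inr y'} :: ('a + 'b) set)" for e by auto
  show "adj (disjoint_union G H) (Inl x) (Inl y) \<longleftrightarrow> adj G x y"
    by (simp add: adj_def disjoint_union_def image_iff Inl Inl' eq_commute[of "{Inl x, Inl y}"])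
  show "adj (disjoint_union G H) (Inr x') (Inr y') \<longleftrightarrow> adj H x' y'"
    by (simp add: adj_def disjoint_union_def image_iff Inr Inr' eq_commute[of "{Inr x', Inr y'}"])
  show "\<not> adj (disjoint_union G H) (Inl x) (Inr y')" "\<not> adj (disjoint_union G H) (Inr x') (Inl y)"
    by (auto simp: adj_def disjoint_union_def)
qed

lemma degree_disjoint_union:
  "degree (disjoint_union G H) (Inl x) = degree G x"
  "degree (disjoint_union G H) (Inr y) = degree H y"
proof -
  have "{u \<in> uverts (disjoint_union G H). adj (disjoint_union G H) (Inl x) u}
      = Inl ` {u \<in> uverts G. adj G x u}"
    using adj_disjoint_union[of G H] by (auto simp: disjoint_union_def)
  then show "degree (disjoint_union G H) (Inl x) = degree G x"
    by (simp add: degree_def card_image)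
  have "{u \<in> uverts (disjoint_union G H). adj (disjoint_union G H) (Inr y) u}
      = Inr ` {u \<in> uverts H. adj H y u}"
    using adj_disjoint_union[of G H] by (auto simp: disjoint_union_def)
  then show "degree (disjoint_union G H) (Inr y) = degree H y"
    by (simp add: degree_def card_image)
qed

lemma num_cliques_disjoint_union_ge:
  assumes "finite (uedges G)" and "finite (uedges H)"
    and "simple_graph G" and "simple_graph H" and "t \<ge> 2"
  shows "num_cliques t G + num_cliques t H \<le> num_cliques t (disjoint_union G H)"
proof -
  let ?U = "disjoint_union G H"
  let ?Q = "\<lambda>G. {K. clique G K \<and> finite K \<and> card K = t}"
  have fin_G: "finite e" if "e \<in> uedges G" for e
    using that assms(3) unfolding simple_graph_def by (metis card.infinite zero_neq_numeral)
  have fin_H: "finite e" if "e \<in> uedges H" for e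
    using that assms(4) unfolding simple_graph_def by (metis card.infinite zero_neq_numeral)
  have fin: "finite (?Q ?U)" "finite (?Q G)" "finite (?Q H)"
    by (rule cliques_finite; use assms fin_G fin_H in \<open>auto simp: disjoint_union_def\<close>)+
  \<comment> \<open>The empty set is the only possible common image, and \<open>t \<ge> 2\<close>
    excludes it.\<close>
  have "image Inl ` ?Q G \<inter> image Inr ` ?Q H = ({} :: ('a + 'b) set set)"
  proof -
    have False if KL: "K \<in> ?Q G" "Inl ` K = (Inr ` L :: ('a + 'b) set)" for K L
    proof -
      have "K \<noteq> {}" using KL(1) assms(5) by auto
      then obtain x where "x \<in> K" by blast
      then have "Inl x \<in> (Inr ` L :: ('a + 'b) set)" using KL(2) by blast
      then show False by blast
    qed
    then show ?thesis by blast
  qed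
  then have "card (image Inl ` ?Q G \<union> image Inr ` ?Q H :: ('a + 'b) set set)
      = card (image Inl ` ?Q G :: ('a + 'b) set set) + card (image Inr ` ?Q H :: ('a + 'b) set set)"
    using fin by (intro card_Un_disjoint) auto
  also have "card (image Inl ` ?Q G :: ('a + 'b) set set) = num_cliques t G"
    unfolding num_cliques_def by (rule card_image) (auto intro!: inj_onI simp: inj_image_eq_iff)
  also have "card (image Inr ` ?Q H :: ('a + 'b) set set) = num_cliques t H"
    unfolding num_cliques_def by (rule card_image) (auto intro!: inj_onI simp: inj_image_eq_iff)
  finally have "num_cliques t G + num_cliques t H
      = card (image Inl ` ?Q G \<union> image Inr ` ?Q H :: ('a + 'b) set set)" ..
  also have "\<dots> \<le> card (?Q ?U)"
  proof (rule card_mono[OF fin(1)])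
    show "image Inl ` ?Q G \<union> image Inr ` ?Q H \<subseteq> ?Q ?U"
    proof (intro Un_least image_subsetI)
      show "Inl ` K \<in> ?Q ?U" if "K \<in> ?Q G" for K
      proof -
        have "Inl ` K \<subseteq> uverts ?U" using that by (auto simp: clique_def disjoint_union_def)
        then show ?thesis using that by (simp add: clique_def adj_disjoint_union card_image)
      qed
      show "Inr ` K \<in> ?Q ?U" if "K \<in> ?Q H" for K
      proof -
        have "Inr ` K \<subseteq> uverts ?U" using that by (auto simp: clique_def disjoint_union_def)
        then show ?thesis using that by (simp add: clique_def adj_disjoint_union card_image)
      qed
    qed
  qed
  finally show ?thesis unfolding num_cliques_def[of t ?U] .
qed


section \<open>Edges and cliques around a tight clique\<close>

locale tight_clique =
  fixes G :: "'a ugraph" and r :: nat and T :: "'a set"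
  assumes simple: "simple_graph G" and fin: "finite (uverts G)"
    and deg: "max_degree_le G r" and tight: "tight G r T"
begin

abbreviation S :: "'a set" where "S \<equiv> common_nbrs G T"

abbreviation W :: "'a set" where "W \<equiv> T \<union> S"

lemma W_subset: "W \<subseteq> uverts G"
  using tight by (auto simp: tight_def clique_def common_nbrs_def)

lemma finite_W: "finite W"
  using W_subset fin finite_subset by blast

lemma card_W: "card W = Suc r"
proof -
  have "T \<inter> S = {}" using adjD(1)[OF simple] by (auto simp: common_nbrs_def)
  then have "card W = card T + card S" using finite_W by (intro card_Un_disjoint) auto
  then show ?thesis using tight by (simp add: tight_def)
qed

lemma T_adj_W:
  assumes "x \<in> T" and "y \<in> W" and "x \<noteq> y"
  shows "adj G x y"
  using assms tight by (auto simp: tight_def clique_def common_nbrs_def)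

text \<open>A vertex of \<open>T\<close> is adjacent to the r other vertices of \<open>W\<close>,
  which already exhausts its degree bound.\<close>

lemma T_nbr_in_W:
  assumes "x \<in> T" and "adj G x y"
  shows "y \<in> W"
proof -
  let ?N = "{u \<in> uverts G. adj G x u}"
  have "W - {x} \<subseteq> ?N" using T_adj_W[OF assms(1)] W_subset by auto
  moreover have "card ?N \<le> card (W - {x})"
    using deg assms(1) W_subset card_W finite_W by (auto simp: max_degree_le_def degree_def)
  moreover have "finite ?N" using fin by simp
  ultimately have "W - {x} = ?N" by (metis card_seteq)
  then show ?thesis using adjD(3)[OF simple assms(2)] assms(2) by auto
qed

text \<open>Vertices of \<open>T\<close> are adjacent to all others in \<open>W\<close>, so every
  non-edge within \<open>W\<close> lies within \<open>S\<close>. Hence R can be treated as the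
  complement of G[W], on exactly r + 1 vertices.\<close>

lemma uedges_R_graph: "uedges (R_graph G T) = {e. e \<subseteq> W \<and> card e = 2 \<and> e \<notin> uedges G}"
proof
  have S: "uverts (induced G S) = S" using W_subset by (auto simp: induced_def)
  have R: "uedges (R_graph G T) = {{u, v} |u v. u \<in> S \<and> v \<in> S \<and> u \<noteq> v \<and> \<not> adj G u v}"
    unfolding R_graph_def complement_def by (auto simp: S) (auto simp: adj_def induced_def)
  show "uedges (R_graph G T) \<subseteq> {e. e \<subseteq> W \<and> card e = 2 \<and> e \<notin> uedges G}"
    by (auto simp: R adj_def)
  show "{e. e \<subseteq> W \<and> card e = 2 \<and> e \<notin> uedges G} \<subseteq> uedges (R_graph G T)"
  proof clarify
    fix e assume e: "e \<subseteq> W" "card e = 2" "e \<notin> uedges G"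
    then obtain u v where uv: "e = {u, v}" "u \<noteq> v" by (auto simp: card_2_iff)
    then have "\<not> adj G u v" "\<not> adj G v u" using e by (auto simp: adj_def insert_commute)
    then have "u \<in> S" "v \<in> S" using e uv T_adj_W by blast+
    then show "e \<in> uedges (R_graph G T)" unfolding R using uv \<open>\<not> adj G u v\<close> by blast
  qed
qed

text \<open>No edge leaves \<open>W\<close> from \<open>T\<close>, so the edges of B are precisely
  those crossing the boundary of \<open>W\<close>.\<close>

lemma uedges_B_graph:
  "uedges (B_graph G T) = {e \<in> uedges G. \<not> e \<subseteq> W \<and> \<not> e \<subseteq> uverts G - W}"
proof
  have B: "uedges (B_graph G T) = {{u, v} |u v. {u, v} \<in> uedges G \<and> u \<in> S \<and> v \<in> uverts G - W}"
    by (simp add: B_graph_def Let_def)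
  show "uedges (B_graph G T) \<subseteq> {e \<in> uedges G. \<not> e \<subseteq> W \<and> \<not> e \<subseteq> uverts G - W}"
    unfolding B by auto
  show "{e \<in> uedges G. \<not> e \<subseteq> W \<and> \<not> e \<subseteq> uverts G - W} \<subseteq> uedges (B_graph G T)"
  proof
    fix e assume "e \<in> {e \<in> uedges G. \<not> e \<subseteq> W \<and> \<not> e \<subseteq> uverts G - W}"
    then obtain u v where e: "e \<in> uedges G" "u \<in> e" "u \<notin> uverts G - W" "v \<in> e" "v \<notin> W"
      by blast
    then have "e \<subseteq> uverts G" "card e = 2" using simple by (auto simp: simple_graph_def)
    then have "u \<in> W" "v \<in> uverts G - W" using e by auto
    then have "e = {u, v}" using e \<open>card e = 2\<close> by (auto simp: card_2_iff)
    moreover have "u \<in> S" using T_nbr_in_W[of u v] \<open>u \<in> W\<close> \<open>e = {u, v}\<close> e by (auto simp: adj_def)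
    ultimately show "e \<in> uedges (B_graph G T)" unfolding B using e \<open>v \<in> uverts G - W\<close> by blast
  qed
qed

text \<open>Edges of G lie outside \<open>W\<close>, cross its boundary or lie inside; the inside
  ones together with R make up all pairs of \<open>W\<close>. Keeping R on the left avoids truncated
  subtraction.\<close>

lemma num_edges_split:
  "num_edges G + num_edges (R_graph G T)
    = num_edges (induced G (uverts G - W)) + num_edges (B_graph G T) + (Suc r choose 2)"
proof -
  let ?I = "{e \<in> uedges G. e \<subseteq> W}" and ?O = "{e \<in> uedges G. e \<subseteq> uverts G - W}"
  have fin_E: "finite (uedges G)" by (rule uedges_finite[OF simple fin])
  have fin_P: "finite {e. e \<subseteq> W \<and> card e = 2}"
    by (rule finite_subset[of _ "Pow W"]) (use finite_W in auto)
  have e2: "e \<noteq> {}" "card e = 2" if "e \<in> uedges G" for e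
    using that simple by (auto simp: simple_graph_def)
  have "uedges G = ?O \<union> uedges (B_graph G T) \<union> ?I" unfolding uedges_B_graph by auto
  then have "num_edges G = card (?O \<union> uedges (B_graph G T) \<union> ?I)" by (simp add: num_edges_def)
  also have "\<dots> = card (?O \<union> uedges (B_graph G T)) + card ?I"
  proof (rule card_Un_disjoint)
    have "\<not> e \<subseteq> uverts G - W" if "e \<in> uedges G" "e \<subseteq> W" for e
      using e2(1)[OF that(1)] that(2) by blast
    then show "(?O \<union> uedges (B_graph G T)) \<inter> ?I = {}" unfolding uedges_B_graph by blast
  qed (use fin_E in \<open>auto simp: uedges_B_graph\<close>)
  also have "card (?O \<union> uedges (B_graph G T)) = card ?O + card (uedges (B_graph G T))"
    using fin_E by (intro card_Un_disjoint) (auto simp: uedges_B_graph)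
  finally have 1: "num_edges G = card ?O + num_edges (B_graph G T) + card ?I"
    by (simp add: num_edges_def)
  have "{e. e \<subseteq> W \<and> card e = 2} = ?I \<union> uedges (R_graph G T)"
    unfolding uedges_R_graph using e2 by auto
  then have "Suc r choose 2 = card (?I \<union> uedges (R_graph G T))"
    using n_subsets[OF finite_W, of 2] card_W by simp
  also have "\<dots> = card ?I + num_edges (R_graph G T)"
    unfolding num_edges_def
    using fin_E finite_subset[OF _ fin_P, of "uedges (R_graph G T)"]
    by (intro card_Un_disjoint) (auto simp: uedges_R_graph)
  finally show ?thesis using 1 by (simp add: num_edges_def induced_def)
qed

text \<open>A clique of size \<open>t + 1\<close> crossing the boundary of \<open>W\<close> is spanned by a double star in \<open>B\<close>, so
  it is recovered as the union of \<open>t\<close> edges of \<open>B\<close>.\<close>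

lemma card_crossing_cliques_le:
  "card {K. clique G K \<and> finite K \<and> card K = Suc t \<and> K \<inter> W \<noteq> {} \<and> K - W \<noteq> {}}
    \<le> num_edges (B_graph G T) choose t" (is "card ?X \<le> _")
proof -
  have fin_B: "finite (uedges (B_graph G T))"
    unfolding uedges_B_graph using uedges_finite[OF simple fin] by simp
  have "K \<in> Union ` {F. F \<subseteq> uedges (B_graph G T) \<and> card F = t}" if "K \<in> ?X" for K
  proof -
    from that have K: "clique G K" "finite K" "card K = Suc t" "K \<inter> W \<noteq> {}" "K - W \<noteq> {}"
      by auto
    then obtain a d where ad: "a \<in> K \<inter> W" "d \<in> K - W" by blast
    have edge: "{x, y} \<in> uedges (B_graph G T)" if "x \<in> K \<inter> W" "y \<in> K - W" for x y
    proof -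
      have "x \<noteq> y" using that by blast
      then have "{x, y} \<in> uedges G" using that K(1) by (simp add: clique_def adj_def)
      then show ?thesis using that unfolding uedges_B_graph by blast
    qed
    \<comment> \<open>A spanning double star with central edge {a, d}. Dropping \<open>a\<close> in
      \<open>?F2\<close> keeps that edge from being counted twice, so the number of edges is the
      number of vertices of \<open>K\<close> other than \<open>a\<close>.\<close>
    let ?F1 = "(\<lambda>y. {a, y}) ` (K - W)" and ?F2 = "(\<lambda>x. {x, d}) ` (K \<inter> W - {a})"
    have "?F1 \<union> ?F2 \<subseteq> uedges (B_graph G T)" using edge ad by blast
    moreover have "\<Union>(?F1 \<union> ?F2) = K" using ad by auto
    moreover have "card (?F1 \<union> ?F2) = t"
    proof -
      have "card (?F1 \<union> ?F2) = card ?F1 + card ?F2"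
        using K(2) ad by (intro card_Un_disjoint) (auto simp: doubleton_eq_iff)
      also have "card ?F1 = card (K - W)"
        by (intro card_image inj_onI) (auto simp: doubleton_eq_iff)
      also have "card ?F2 = card (K \<inter> W - {a})"
        by (intro card_image inj_onI) (auto simp: doubleton_eq_iff)
      also have "card (K - W) + card (K \<inter> W - {a}) = card ((K - W) \<union> (K \<inter> W - {a}))"
        using K(2) by (intro card_Un_disjoint[symmetric]) auto
      also have "(K - W) \<union> (K \<inter> W - {a}) = K - {a}" using ad by blast
      also have "card (K - {a}) = t" using K ad by simp
      finally show ?thesis .
    qed
    ultimately show ?thesis by (intro image_eqI[of _ _ "?F1 \<union> ?F2"]) simp_all
  qed
  then have "?X \<subseteq> Union ` {F. F \<subseteq> uedges (B_graph G T) \<and> card F = t}" by blast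
  moreover have fin_F: "finite {F. F \<subseteq> uedges (B_graph G T) \<and> card F = t}"
    by (rule finite_subset[of _ "Pow (uedges (B_graph G T))"]) (use fin_B in auto)
  ultimately have "card ?X \<le> card {F. F \<subseteq> uedges (B_graph G T) \<and> card F = t}"
    by (rule surj_card_le[rotated])
  then show ?thesis by (simp add: n_subsets[OF fin_B] num_edges_def)
qed

text \<open>Cliques are sorted into those avoiding \<open>W\<close> (\<open>?O\<close>), those
  inside it (\<open>?I\<close>) and those crossing its boundary (\<open>?X\<close>). Inside
  \<open>W\<close> a clique contains no edge of R, so the bound for edge-free subsets of an
  (r+1)-set applies.\<close>

lemma num_cliques_le:
  assumes "num_edges (R_graph G T) \<le> r"
  shows "num_cliques (k + 2) G \<le> num_cliques (k + 2) (induced G (uverts G - W))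
    + (r choose (k + 2)) + ((r - num_edges (R_graph G T)) choose (k + 1))
    + (num_edges (B_graph G T) choose (k + 1))"
proof -
  let ?O = "{K. clique (induced G (uverts G - W)) K \<and> finite K \<and> card K = k + 2}"
  let ?I = "{K. K \<subseteq> W \<and> card K = k + 2 \<and> (\<forall>e\<in>uedges (R_graph G T). \<not> e \<subseteq> K)}"
  let ?X = "{K. clique G K \<and> finite K \<and> card K = Suc (k + 1) \<and> K \<inter> W \<noteq> {} \<and> K - W \<noteq> {}}"
  have fin_R: "finite (uedges (R_graph G T))"
    by (rule finite_subset[of _ "Pow W"]) (use finite_W in \<open>auto simp: uedges_R_graph\<close>)
  have sub: "{K. clique G K \<and> finite K \<and> card K = k + 2} \<subseteq> ?O \<union> ?I \<union> ?X"
  proof (rule subsetI, rule ccontr)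
    fix K assume "K \<in> {K. clique G K \<and> finite K \<and> card K = k + 2}" "K \<notin> ?O \<union> ?I \<union> ?X"
    then have K: "clique G K" "finite K" "card K = k + 2" "K \<notin> ?O" "K \<notin> ?I" "K \<notin> ?X"
      by blast+
    have "\<not> e \<subseteq> K" if "e \<in> uedges (R_graph G T)" for e
    proof
      assume "e \<subseteq> K"
      moreover have "card e = 2" "e \<notin> uedges G" using that by (simp_all add: uedges_R_graph)
      moreover from this obtain u v where "e = {u, v}" "u \<noteq> v" by (auto simp: card_2_iff)
      ultimately show False using K(1) by (auto simp: clique_def adj_def)
    qed
    \<comment> \<open>Containing no edge of R but missing from \<open>?I\<close>, \<open>K\<close>
      is not inside \<open>W\<close>; missing from \<open>?X\<close> too, it must avoid
      \<open>W\<close>, which puts it in \<open>?O\<close>.\<close>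
    then have "\<not> K \<subseteq> W" using K by auto
    then have "K \<inter> W = {}" using K by auto
    then have "clique (induced G (uverts G - W)) K"
      using K(1) by (fastforce simp: clique_def induced_def adj_def)
    then show False using K by blast
  qed
  have subs: "?O \<subseteq> Pow (uverts G)" "?I \<subseteq> Pow (uverts G)" "?X \<subseteq> Pow (uverts G)"
    using W_subset by (auto simp: clique_def induced_def)
  have "num_cliques (k + 2) G \<le> card (?O \<union> ?I \<union> ?X)"
    unfolding num_cliques_def using sub subs fin
    by (intro card_mono finite_UnI) (auto intro: finite_subset[of _ "Pow (uverts G)"])
  also have "\<dots> \<le> card ?O + card ?I + card ?X"
    by (metis (no_types, lifting) add_le_mono1 card_Un_le order_trans)
  finally show ?thesis
    using card_crossing_cliques_le[of "k + 1"]
      card_edge_free_subsets_le[OF fin_R finite_W card_W, of k] assms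
    by (simp add: num_cliques_def num_edges_def uedges_R_graph)
qed

end

section \<open>Comparing the graph with its folding\<close>

theorem theorem3p5:
  fixes G :: "'a ugraph" and T :: "'a set" and m r :: nat
  assumes "r \<ge> 1"
    and "simple_graph G" and "finite (uverts G)"
    and "connected_graph G"
    and "num_edges G = m"
    and "max_degree_le G r"
    and "cluster G r T"
    and "num_edges (B_graph G T) < num_edges (R_graph G T)"
    and "num_edges (R_graph G T) \<le> r"
  shows "num_edges (colex_folding G r T) = m
       \<and> max_degree_le (colex_folding G r T) r
       \<and> (\<forall>t\<ge>2. num_cliques t (colex_folding G r T) \<ge> num_cliques t G)"
proof -
  interpret tight_clique G r T
    using assms by unfold_locales (auto simp: cluster_def)
  \<comment> \<open>\<open>c\<close> is the number of neighbours of the vertex \<open>Suc r\<close>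
    in the colex component, obtained from \<open>Suc r choose 2 = (r choose 2) + r\<close>. As e(R)
    \<le> r, no subtraction truncates.\<close>
  define c where "c = r - num_edges (R_graph G T) + num_edges (B_graph G T)"
  have c: "c < r" using assms(8,9) by (simp add: c_def)
  let ?H = "induced G (uverts G - W)" and ?C = "colex_graph ((r choose 2) + c)"
  have "(r + 1 choose 2) - num_edges (R_graph G T) + num_edges (B_graph G T) = (r choose 2) + c"
    using assms(9) by (simp add: c_def numeral_2_eq_2)
  then have fold: "colex_folding G r T = disjoint_union ?H ?C"
    by (simp add: colex_folding_def)
  have simple_H: "simple_graph ?H"
    using simple by (auto simp: simple_graph_def induced_def)
  have fin_H: "finite (uedges ?H)"
    by (rule uedges_finite[OF simple_H]) (simp add: induced_def fin)
  have "num_edges (colex_folding G r T) = num_edges ?H + ((r choose 2) + c)"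
    unfolding fold using simple_H fin_H
    by (subst num_edges_disjoint_union)
      (auto simp: finite_uedges_colex num_edges_colex_graph[OF c] simple_graph_def)
  then have "num_edges (colex_folding G r T) = m"
    using num_edges_split assms(5,9) by (simp add: c_def numeral_2_eq_2)
  moreover have "max_degree_le (colex_folding G r T) r"
    unfolding max_degree_le_def
  proof
    fix v assume v: "v \<in> uverts (colex_folding G r T)"
    show "degree (colex_folding G r T) v \<le> r"
    proof (cases v)
      case (Inl x)
      then have x: "x \<in> uverts G" using v by (auto simp: fold disjoint_union_def induced_def)
      have "degree ?H x \<le> degree G x"
        unfolding degree_def by (rule card_mono) (auto simp: fin induced_def adj_def)
      also have "\<dots> \<le> r" using deg x by (simp add: max_degree_le_def)
      finally show ?thesis by (simp add: Inl fold degree_disjoint_union)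
    next
      case (Inr y)
      then show ?thesis by (simp add: fold degree_disjoint_union degree_colex_graph_le[OF c])
    qed
  qed
  moreover have "num_cliques t G \<le> num_cliques t (colex_folding G r T)" if "t \<ge> 2" for t
  proof -
    from that obtain k where t: "t = k + 2" by (metis add.commute le_Suc_ex)
    \<comment> \<open>Superadditivity merges the star term with index r - e(R) and the crossing term
      with index e(B) into one term with index \<open>c\<close>; the lower index k + 1 is positive
      because \<open>t \<ge> 2\<close>.\<close>
    have "num_cliques t G \<le> num_cliques t ?H + (r choose (k + 2)) + (c choose (k + 1))"
      using num_cliques_le[OF assms(9), of k] unfolding t c_def
      using binomial_superadditive[of "r - num_edges (R_graph G T)" k "num_edges (B_graph G T)"]
      by simp
    also have "\<dots> \<le> num_cliques t ?H + num_cliques t ?C"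
      using num_cliques_colex_graph_ge[OF c, of k] t by simp
    also have "\<dots> \<le> num_cliques t (colex_folding G r T)"
      unfolding fold
      by (intro num_cliques_disjoint_union_ge fin_H finite_uedges_colex simple_H simple_graph_colex that)
    finally show ?thesis .
  qed
  ultimately show ?thesis by blast
qed

end
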